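(* Let $\mathcal X\subseteq\mathbb{R}^n$ be a nonempty closed convex set, let $h$ be a differentiable strictly convex function on a convex set $\Omega\supseteq\mathcal X$, and let $f:\mathcal X\to\mathbb{R}$ be a continuously differentiable function that is $\alpha$-strongly convex relative to $h$ for some $\alpha>0$, and bounded above on $\mathcal X$ by $f^*<+\infty$. Let $x^0\in\mathcal X$ be arbitrary and let $(x^t)_{t\ge0}$ be generated by the greedy Frank-Wolfe (GFW) algorithm for maximizing $f$ over $\mathcal X$ started at $x^0$. Then for every $\epsilon>0$ there is a pair of consecutive iterates $(x^t,x^{t+1})$ with $$D_h(x^{t+1}\,\Vert\,x^t)\le\epsilon$$ and $0\le t\le\left\lceil\dfrac{f^*-f(x^0)}{\alpha\epsilon}\right\rceil$.
   Context: $\langle\cdot,\cdot\rangle$ is the Euclidean inner product and $\nabla$ denotes the gradient. Bregman divergence of $h$: $D_h(y\,\Vert\,x)=h(y)-h(x)-\langle\nabla h(x),y-x\rangle$ for $x,y\in\Omega$. A differentiable function $f$ with domain contained in $\Omega$ is $\alpha$-strongly convex relative to $h$ if $f(y)\ge f(x)+\langle\nabla f(x),y-x\rangle+\alpha D_h(y\,\Vert\,x)$ for all $x,y$ in the domain of $f$. GFW algorithm for maximizing $f$ over $\mathcal X$: starting from $x^0\in\mathcal X$, for each $t\ge0$ choose $x^{t+1}\in\arg\max_{x\in\mathcal X}\langle\nabla f(x^t),x-x^t\rangle$. *)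

theory Defs
  imports "HOL-Analysis.Analysis"
begin

text \<open>
  A gradient is a vector field on the domain that represents the derivative taken within
  the domain. On a convex domain with empty interior such a field need not be unique, but its inner
  products with feasible directions \<open>y - x\<close> (the only way gradients are used below) are.
\<close>

definition gradient_on ::
    "('a::real_inner \<Rightarrow> real) \<Rightarrow> ('a \<Rightarrow> 'a) \<Rightarrow> 'a set \<Rightarrow> bool" where
  "gradient_on f gf S \<longleftrightarrow> (\<forall>x\<in>S. (f has_derivative (\<lambda>v. gf x \<bullet> v)) (at x within S))"

definition strictly_convex_on :: "'a::real_vector set \<Rightarrow> ('a \<Rightarrow> real) \<Rightarrow> bool" where
  "strictly_convex_on S h \<longleftrightarrow> convex S \<and>
     (\<forall>x\<in>S. \<forall>y\<in>S. \<forall>u. x \<noteq> y \<longrightarrow> 0 < u \<longrightarrow> u < 1 \<longrightarrow>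
        h ((1 - u) *\<^sub>R x + u *\<^sub>R y) < (1 - u) * h x + u * h y)"

text \<open>In \<open>bregman h gh y x\<close>, the field \<open>gh\<close> is a gradient of \<open>h\<close>; this is \<open>D\<^sub>h(y \<parallel> x)\<close>.\<close>

definition bregman ::
    "('a::real_inner \<Rightarrow> real) \<Rightarrow> ('a \<Rightarrow> 'a) \<Rightarrow> 'a \<Rightarrow> 'a \<Rightarrow> real" where
  "bregman h gh y x = h y - h x - gh x \<bullet> (y - x)"

definition rel_strongly_convex_on ::
    "'a::real_inner set \<Rightarrow> ('a \<Rightarrow> real) \<Rightarrow> ('a \<Rightarrow> 'a) \<Rightarrow>
      ('a \<Rightarrow> real) \<Rightarrow> ('a \<Rightarrow> 'a) \<Rightarrow> real \<Rightarrow> bool" where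
  "rel_strongly_convex_on X f gf h gh \<alpha> \<longleftrightarrow>
     (\<forall>x\<in>X. \<forall>y\<in>X. f y \<ge> f x + gf x \<bullet> (y - x) + \<alpha> * bregman h gh y x)"

definition gfw_iterates ::
    "'a::real_inner set \<Rightarrow> ('a \<Rightarrow> 'a) \<Rightarrow> 'a \<Rightarrow> (nat \<Rightarrow> 'a) \<Rightarrow> bool" where
  "gfw_iterates X gf x0 x \<longleftrightarrow> x0 \<in> X \<and> x 0 = x0 \<and>
     (\<forall>t. is_arg_max (\<lambda>z. gf (x t) \<bullet> (z - x t)) (\<lambda>z. z \<in> X) (x (Suc t)))"

end

theory Submission
  imports Defs
begin

text \<open>
  Since \<open>x t\<close> itself is feasible, the maximum defining \<open>x (t + 1)\<close> is nonnegative, so relative strong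
  convexity makes \<open>f\<close> grow by at least \<open>\<alpha> D\<^sub>h(x (t + 1) \<parallel> x t)\<close> in each step. The divergences of
  consecutive iterates therefore sum to at most \<open>(fstar - f x0) / \<alpha>\<close>.
\<close>

lemma gfw_iterates_in:
  assumes "gfw_iterates X gf x0 x"
  shows "x t \<in> X"
  using assms by (cases t) (auto simp: gfw_iterates_def is_arg_max_def)

lemma gfw_step_nonneg:
  assumes "gfw_iterates X gf x0 x"
  shows "0 \<le> gf (x t) \<bullet> (x (Suc t) - x t)"
proof -
  have "gf (x t) \<bullet> (x t - x t) \<le> gf (x t) \<bullet> (x (Suc t) - x t)"
    using assms gfw_iterates_in[OF assms, of t]
    unfolding gfw_iterates_def is_arg_max_linorder by blast
  then show ?thesis by simp
qed

lemma gfw_bregman_le: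
  assumes "gfw_iterates X gf x0 x" and "rel_strongly_convex_on X f gf h gh \<alpha>"
  shows "\<alpha> * bregman h gh (x (Suc t)) (x t) \<le> f (x (Suc t)) - f (x t)"
proof -
  have "f (x (Suc t)) \<ge> f (x t) + gf (x t) \<bullet> (x (Suc t) - x t)
      + \<alpha> * bregman h gh (x (Suc t)) (x t)"
    using assms(2) gfw_iterates_in[OF assms(1)] by (simp add: rel_strongly_convex_on_def)
  with gfw_step_nonneg[OF assms(1), of t] show ?thesis by linarith
qed

text \<open>The one-step gains of \<open>f\<close> telescope. For \<alpha> > 0, an upper bound of
  \<open>f\<close> on \<open>X\<close> thus limits how many of the divergences can exceed a given
  \<epsilon>.\<close>

lemma gfw_sum_bregman_le:
  assumes "gfw_iterates X gf x0 x" and "rel_strongly_convex_on X f gf h gh \<alpha>"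
  shows "\<alpha> * (\<Sum>t<n. bregman h gh (x (Suc t)) (x t)) \<le> f (x n) - f x0"
proof -
  have "\<alpha> * (\<Sum>t<n. bregman h gh (x (Suc t)) (x t)) \<le> (\<Sum>t<n. f (x (Suc t)) - f (x t))"
    unfolding sum_distrib_left by (intro sum_mono gfw_bregman_le[OF assms])
  also have "\<dots> = f (x n) - f x0"
    using assms(1) sum_lessThan_telescope[of "\<lambda>t. f (x t)" n] by (simp add: gfw_iterates_def)
  finally show ?thesis .
qed

theorem theorem5:
  fixes X \<Omega> :: "(real ^ 'n) set"
    and f h :: "real ^ 'n \<Rightarrow> real"
    and gf gh :: "real ^ 'n \<Rightarrow> real ^ 'n"
    and \<alpha> fstar \<epsilon> :: real
    and x0 :: "real ^ 'n"
    and x :: "nat \<Rightarrow> real ^ 'n"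
  assumes "X \<noteq> {}" and "closed X" and "convex X"
    and "convex \<Omega>" and "X \<subseteq> \<Omega>"
    and "gradient_on h gh \<Omega>" and "strictly_convex_on \<Omega> h"
    and "gradient_on f gf X" and "continuous_on X gf"
    and "\<alpha> > 0" and "rel_strongly_convex_on X f gf h gh \<alpha>"
    and "\<forall>z\<in>X. f z \<le> fstar"
    and "x0 \<in> X" and "gfw_iterates X gf x0 x"
    and "\<epsilon> > 0"
  shows "\<exists>t. bregman h gh (x (Suc t)) (x t) \<le> \<epsilon> \<and>
             int t \<le> \<lceil>(fstar - f x0) / (\<alpha> * \<epsilon>)\<rceil>"
proof (rule ccontr)
  define c where "c = (fstar - f x0) / (\<alpha> * \<epsilon>)"
  \<comment> \<open>\<open>N\<close> is the last index allowed by the claim, so the negated claim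
    makes \<open>Suc N\<close> divergences large, those with indices 0 to \<open>N\<close>.\<close>
  define N where "N = nat \<lceil>c\<rceil>"
  assume "\<not> ?thesis"
  moreover have "int t \<le> \<lceil>c\<rceil>" if "t < Suc N" for t
  proof -
    \<comment> \<open>This follows from \<open>f x0 \<le> fstar\<close>. It ensures that
      \<open>nat\<close> truncates nothing, so that \<open>int N\<close> equals the ceiling of
      \<open>c\<close>.\<close>
    have "0 \<le> c"
      using assms by (simp add: c_def)
    with that show ?thesis
      unfolding N_def by linarith
  qed
  ultimately have big: "\<epsilon> < bregman h gh (x (Suc t)) (x t)" if "t < Suc N" for t
    using that unfolding c_def by (meson not_le)
  have "fstar - f x0 = \<alpha> * (\<epsilon> * c)"
    using \<open>\<alpha> > 0\<close> \<open>\<epsilon> > 0\<close> by (simp add: c_def)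
  also have "\<dots> < \<alpha> * (\<epsilon> * Suc N)"
  proof -
    \<comment> \<open>The extra term beyond \<open>N\<close> makes this strict even when
      \<open>c\<close> is an integer, in particular when \<open>c = 0\<close>. The final
      contradiction takes its strictness from here.\<close>
    have "c < Suc N"
      unfolding N_def by linarith
    then show ?thesis
      using \<open>\<alpha> > 0\<close> \<open>\<epsilon> > 0\<close> by simp
  qed
  also have "\<dots> = \<alpha> * (\<Sum>t<Suc N. \<epsilon>)"
    by (simp add: algebra_simps)
  also have "\<dots> \<le> \<alpha> * (\<Sum>t<Suc N. bregman h gh (x (Suc t)) (x t))"
    \<comment> \<open>Termwise comparison over the indices below \<open>Suc N\<close>, exactly the
      range covered by \<open>big\<close>.\<close>
    using \<open>\<alpha> > 0\<close> big by (intro mult_left_mono sum_mono) (auto intro: less_imp_le)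
  also have "\<dots> \<le> f (x (Suc N)) - f x0"
    using assms by (intro gfw_sum_bregman_le)
  also have "\<dots> \<le> fstar - f x0"
    using \<open>\<forall>z\<in>X. f z \<le> fstar\<close> gfw_iterates_in[OF \<open>gfw_iterates X gf x0 x\<close>] by simp
  finally show False by simp
qed

end
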